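(* Let $V$ be a vector space over a field, let $U$ be a subspace of $V$ with $U\neq V$, and let $L_{GL(U)}(V)=\{\alpha\in L(V):\alpha|_U\in GL(U)\}$. The proper ideals of $L_{GL(U)}(V)$ are precisely the sets \[ Q(k)=\{\alpha\in L_{GL(U)}(V):\dim(V\alpha/U)<k\} \] where $k$ is a cardinal with $1\leq k\leq\dim(V/U)$.
   Context: $L(V)$ is the semigroup of all linear maps $V\to V$ under composition; maps are written on the right and composed from left to right, and $V\alpha$ is the range of $\alpha$. $GL(U)$ is the group of all bijective linear maps $U\to U$; $\alpha|_U\in GL(U)$ means that $\alpha$ restricts to a bijection of $U$ onto $U$ (so $U\subseteq V\alpha$). $V$ may be infinite-dimensional; dimensions are cardinals. An ideal of a semigroup $S$ is a nonempty subset $I$ with $SI\subseteq I$ and $IS\subseteq I$; it is proper if $I\neq S$. *)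

theory Defs
  imports Complex_Main "HOL-Library.Set_Algebras"
begin

unbundle cardinal_syntax

text \<open>
  The vector space \<open>V\<close> is the whole type \<open>'b\<close>, with the scalar multiplication \<open>scale\<close> of a
  \<open>vector_space\<close>; its dimension is unrestricted. A quotient \<open>W/U\<close> of subspaces \<open>U \<subseteq> W\<close> of \<open>V\<close> is the
  set of cosets \<open>w +o U\<close> with \<open>w \<in> W\<close>, on which addition is the setwise sum and the zero vector
  is \<open>U\<close> itself.
\<close>

definition quotient_space :: "'b::ab_group_add set \<Rightarrow> 'b set \<Rightarrow> 'b set set" where
  "quotient_space W U = (\<lambda>w. w +o U) ` W"

text \<open>
  The setwise sum with \<open>U\<close> only matters for \<open>c = 0\<close>, where \<open>scale c ` X\<close> is \<open>{0}\<close> and not the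
  coset \<open>U\<close>.
\<close>

definition quotient_scale ::
    "('a::field \<Rightarrow> 'b::ab_group_add \<Rightarrow> 'b) \<Rightarrow> 'b set \<Rightarrow> 'a \<Rightarrow> 'b set \<Rightarrow> 'b set" where
  "quotient_scale scale U c X = scale c ` X + U"

text \<open>
  The sum is the setwise one, so the empty sum is \<open>{0}\<close>; adding \<open>U\<close> turns it into the zero coset
  and leaves every nonempty sum of cosets unchanged.
\<close>

definition quotient_comb ::
    "('a::field \<Rightarrow> 'b::ab_group_add \<Rightarrow> 'b) \<Rightarrow> 'b set \<Rightarrow> ('b set \<Rightarrow> 'a) \<Rightarrow> 'b set set \<Rightarrow> 'b set" where
  "quotient_comb scale U f T = (\<Sum>X\<in>T. quotient_scale scale U (f X) X) + U"

definition quotient_basis ::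
    "('a::field \<Rightarrow> 'b::ab_group_add \<Rightarrow> 'b) \<Rightarrow> 'b set \<Rightarrow> 'b set \<Rightarrow> 'b set set \<Rightarrow> bool" where
  "quotient_basis scale W U B \<longleftrightarrow>
     B \<subseteq> quotient_space W U \<and>
     (\<forall>T f. finite T \<and> T \<subseteq> B \<and> quotient_comb scale U f T = U \<longrightarrow> (\<forall>X\<in>T. f X = 0)) \<and>
     (\<forall>X\<in>quotient_space W U. \<exists>T f. finite T \<and> T \<subseteq> B \<and> X = quotient_comb scale U f T)"

text \<open>
  The dimension of \<open>W/U\<close> as a cardinal, to be compared by \<open>\<le>o\<close> and \<open><o\<close>, i.e. up to
  equipotence. Bases exist and are equipotent, so the choice is immaterial. Every cardinal
  below \<open>dim (W/U)\<close>, whatever its type, is order-isomorphic to one on the type \<open>'b set\<close>, so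
  cardinals bounded by this dimension can be taken of type \<open>'b set rel\<close>.
\<close>

definition quotient_dim ::
    "('a::field \<Rightarrow> 'b::ab_group_add \<Rightarrow> 'b) \<Rightarrow> 'b set \<Rightarrow> 'b set \<Rightarrow> 'b set rel" where
  "quotient_dim scale W U = |SOME B. quotient_basis scale W U B|"

text \<open>
  Linearity of the restriction to \<open>U\<close> is inherited from \<open>\<alpha>\<close>.
\<close>

definition L_GL :: "('a::field \<Rightarrow> 'b::ab_group_add \<Rightarrow> 'b) \<Rightarrow> 'b set \<Rightarrow> ('b \<Rightarrow> 'b) set" where
  "L_GL scale U = {\<alpha>. Vector_Spaces.linear scale scale \<alpha> \<and> bij_betw \<alpha> U U}"

definition proper_ideal :: "('s \<Rightarrow> 's \<Rightarrow> 's) \<Rightarrow> 's set \<Rightarrow> 's set \<Rightarrow> bool" where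
  "proper_ideal mult S I \<longleftrightarrow>
     I \<subseteq> S \<and> I \<noteq> {} \<and>
     (\<forall>s\<in>S. \<forall>a\<in>I. mult s a \<in> I) \<and> (\<forall>a\<in>I. \<forall>s\<in>S. mult a s \<in> I) \<and>
     I \<noteq> S"

definition Q :: "('a::field \<Rightarrow> 'b::ab_group_add \<Rightarrow> 'b) \<Rightarrow> 'b set \<Rightarrow> 'c rel \<Rightarrow> ('b \<Rightarrow> 'b) set" where
  "Q scale U k = {\<alpha> \<in> L_GL scale U. quotient_dim scale (range \<alpha>) U <o k}"

text \<open>
  Maps are written on the right, so the product \<open>\<alpha>\<beta>\<close> applies \<open>\<alpha>\<close> first.
\<close>

definition right_comp :: "('b \<Rightarrow> 'b) \<Rightarrow> ('b \<Rightarrow> 'b) \<Rightarrow> 'b \<Rightarrow> 'b" where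
  "right_comp \<alpha> \<beta> = \<beta> \<circ> \<alpha>"

end

theory Submission
  imports Defs
begin

text \<open>
  Fix a linear projection \<open>p\<close> of \<open>V\<close> with kernel \<open>U\<close>. It maps cosets of \<open>U\<close> to vectors, so that
  \<open>dim (W/U)\<close> is the dimension of \<open>p ` W\<close>. If \<open>\<alpha>, \<beta>\<close> lie in the semigroup and
  \<open>dim (V\<beta>/U) \<le> dim (V\<alpha>/U)\<close>, then there are semigroup elements \<open>\<sigma>, \<tau>\<close> such that \<open>\<sigma>\<alpha>\<tau>\<close> is the
  identity on \<open>V\<beta>\<close>, whence \<open>\<beta> = (\<beta>\<sigma>)\<alpha>\<tau>\<close> lies in every ideal containing \<open>\<alpha>\<close>. A proper ideal is
  therefore \<open>Q(k)\<close>, where \<open>k\<close> is the least \<open>dim (V\<beta>/U)\<close> of a map \<open>\<beta>\<close> outside the ideal.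
\<close>

section \<open>Linear algebra and coset arithmetic for a subspace\<close>

context vector_space
begin

text \<open>Two bases of one subspace are equipotent, also in infinite dimension: thin out
  \<open>E\<close> to a basis of its span, and extend \<open>D\<close> to another basis of that
  span.\<close>

lemma independent_card_of_le:
  assumes "independent D" and "D \<subseteq> span E"
  shows "|D| \<le>o |E|"
proof -
  obtain E' where E': "E' \<subseteq> E" "independent E'" "E \<subseteq> span E'"
    using maximal_independent_subset by blast
  obtain D' where D': "D \<subseteq> D'" "D' \<subseteq> span E" "independent D'" "span E \<subseteq> span D'"
    using maximal_independent_subset_extend[OF assms(2,1)] by blast
  have "span D' = span E'"
    using D' E' by (metis span_mono span_span subset_antisym)
  then obtain f where "bij_betw f D' E'"
    using bij_if_span_eq_span_bases D'(3) E'(2) by blast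
  then have "inj_on f D" "f ` D \<subseteq> E"
    using D'(1) E'(1) by (auto simp: bij_betw_def intro: inj_on_subset)
  then show ?thesis
    by (auto simp: card_of_ordLeq[symmetric])
qed

lemma exists_projection_with_kernel:
  assumes "subspace U"
  shows "\<exists>p. Vector_Spaces.linear scale scale p \<and> (\<forall>x. p (p x) = p x) \<and> {x. p x = 0} = U"
proof -
  interpret pair: vector_space_pair scale scale ..
  have id: "Vector_Spaces.linear scale scale id" by (rule linear_id)
  \<comment> \<open>A left inverse on \<open>U\<close> of the identity, with values in
    \<open>U\<close>, is a linear retraction onto \<open>U\<close>; the projection sought is the
    complementary one.\<close>
  obtain g where g: "range g \<subseteq> U" "Vector_Spaces.linear scale scale g" "\<And>v. v \<in> U \<Longrightarrow> g v = v"
    using pair.linear_exists_left_inverse_on[OF id assms] by auto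
  let ?p = "\<lambda>x. x - g x"
  have "Vector_Spaces.linear scale scale ?p"
    using pair.linear_compose_sub[OF id g(2)] by simp
  moreover have g_U: "g x \<in> U" for x
    using g(1) by blast
  then have "?p (?p x) = ?p x" for x
    using g(3) pair.linear_diff[OF g(2)] by simp
  moreover have "?p x = 0 \<longleftrightarrow> x \<in> U" for x
    using g_U[of x] g(3) by auto
  ultimately show ?thesis by blast
qed

lemma subspace_plus_self: "subspace U \<Longrightarrow> U + U = U"
  using subspace_add[of U] subspace_0[of U] set_zero_plus2[of U U]
  by (auto elim!: set_plus_elim)

lemma coset_plus: "subspace U \<Longrightarrow> (x +o U) + (y +o U) = (x + y) +o U"
  by (simp add: set_plus_rearrange subspace_plus_self)

lemma quotient_scale_coset:
  assumes U: "subspace U"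
  shows "quotient_scale scale U c (x +o U) = scale c x +o U"
proof -
  have "scale c ` (x +o U) = scale c x +o scale c ` U"
    by (force simp: elt_set_plus_def scale_right_distrib)
  \<comment> \<open>For \<open>c = 0\<close> the scaled set is only {0}; adding \<open>U\<close>
    restores the zero coset.\<close>
  moreover have "scale c ` U + U = U"
    using U subspace_add[OF U] subspace_scale[OF U] subspace_0[OF U]
    by (force simp: set_plus_def image_iff)
  ultimately show ?thesis
    by (simp add: quotient_scale_def set_plus_rearrange3)
qed

lemma quotient_comb_cosets:
  assumes U: "subspace U" and "finite T" and inj: "inj_on (\<lambda>d. d +o U) T"
  shows "quotient_comb scale U f ((\<lambda>d. d +o U) ` T) = (\<Sum>d\<in>T. scale (f (d +o U)) d) +o U"
proof -
  \<comment> \<open>Injectivity on \<open>T\<close> lets the sum over cosets be reindexed by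
    representatives, so the induction can run over vectors.\<close>
  have "(\<Sum>d\<in>T. quotient_scale scale U (f (d +o U)) (d +o U)) + U
      = (\<Sum>d\<in>T. scale (f (d +o U)) d) +o U"
    using \<open>finite T\<close>
  proof induction
    case empty
    then show ?case by simp
  next
    case (insert d T)
    then show ?case
      by (simp add: quotient_scale_coset[OF U] add.assoc coset_plus[OF U])
  qed
  then show ?thesis
    by (simp add: quotient_comb_def sum.reindex[OF inj])
qed

end

section \<open>Dimensions of quotients by the kernel of a projection\<close>

locale projection = vector_space scale
  for scale :: "'a::field \<Rightarrow> 'b::ab_group_add \<Rightarrow> 'b" +
  fixes U :: "'b set" and p :: "'b \<Rightarrow> 'b"
  assumes linear_p: "Vector_Spaces.linear scale scale p"
    and idem [simp]: "p (p x) = p x"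
    and kernel: "{x. p x = 0} = U"
begin

sublocale pair: vector_space_pair scale scale ..

sublocale p: Vector_Spaces.linear scale scale p by (fact linear_p)

lemma in_U_iff: "x \<in> U \<longleftrightarrow> p x = 0"
  using kernel by auto

lemma subspace_U: "subspace U"
  using p.subspace_kernel by (simp add: kernel)

lemma diff_p_in_U: "x - p x \<in> U"
  by (simp add: in_U_iff p.diff)

lemma coset_eq_iff: "x +o U = y +o U \<longleftrightarrow> p x = p y"
proof
  assume "x +o U = y +o U"
  then have "x \<in> y +o U"
    using subspace_0[OF subspace_U] by (auto simp: elt_set_plus_def)
  then show "p x = p y"
    by (auto simp: elt_set_plus_def in_U_iff p.add)
next
  assume eq: "p x = p y"
  then have "z - x \<in> U \<longleftrightarrow> z - y \<in> U" for z
    by (simp add: in_U_iff p.diff)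
  then show "x +o U = y +o U"
    using set_minus_plus by blast
qed

lemma coset_eq_U_iff: "x +o U = U \<longleftrightarrow> p x = 0"
  using coset_eq_iff[of x 0] p.zero by simp

lemma inj_on_coset: "D \<subseteq> range p \<Longrightarrow> inj_on (\<lambda>d. d +o U) D"
  unfolding inj_on_def coset_eq_iff by (metis idem rangeE subsetD)

lemma p_fixes_span:
  assumes "D \<subseteq> range p" and "x \<in> span D"
  shows "p x = x"
  using span_minimal[OF assms(1) p.subspace_image[OF subspace_UNIV]] assms(2) by auto

lemma quotient_space_eq: "quotient_space W U = (\<lambda>d. d +o U) ` p ` W"
  unfolding quotient_space_def image_image by (rule image_cong) (simp_all add: coset_eq_iff)

text \<open>The projection fixes the span of \<open>D\<close>. Hence distinct vectors of
  \<open>D\<close> represent distinct cosets, and two combinations of them are equal as soon as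
  their cosets are; independence and spanning carry over in both directions.\<close>

lemma quotient_basis_cosets_iff:
  assumes W: "subspace W" and D: "D \<subseteq> p ` W"
  shows "quotient_basis scale W U ((\<lambda>d. d +o U) ` D) \<longleftrightarrow> independent D \<and> span D = p ` W"
proof -
  let ?c = "\<lambda>d. d +o U"
  have Dp: "D \<subseteq> range p" using D by auto
  have comb: "quotient_comb scale U f (?c ` T) = ?c (\<Sum>d\<in>T. scale (f (?c d)) d)"
    if "finite T" "T \<subseteq> D" for T f
    using that Dp by (intro quotient_comb_cosets subspace_U inj_on_coset) auto
  have p_sum: "p (\<Sum>d\<in>T. scale (u d) d) = (\<Sum>d\<in>T. scale (u d) d)"
    if "T \<subseteq> D" for T and u :: "'b \<Rightarrow> 'a"
    using that by (intro p_fixes_span[OF Dp] span_sum span_scale span_base) auto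
  \<comment> \<open>Coefficients in the quotient are indexed by cosets; inverting the coset map on
    \<open>D\<close> transports coefficients indexed by vectors.\<close>
  have coeff: "\<exists>f. \<forall>d\<in>D. f (?c d) = u d" for u :: "'b \<Rightarrow> 'a"
    by (intro exI[of _ "\<lambda>X. u (inv_into D ?c X)"])
      (simp add: inv_into_f_f[OF inj_on_coset[OF Dp]])
  have sums: "(\<Sum>d\<in>T. scale (f (?c d)) d) = (\<Sum>d\<in>T. scale (u d) d)"
    if "\<forall>d\<in>D. f (?c d) = u d" "T \<subseteq> D" for f and u :: "'b \<Rightarrow> 'a" and T
    using that by (intro sum.cong) auto
  have subs: "?c ` D \<subseteq> quotient_space W U"
    using D by (auto simp: quotient_space_eq)
  have indep: "(\<forall>T f. finite T \<and> T \<subseteq> ?c ` D \<and> quotient_comb scale U f T = U \<longrightarrow> (\<forall>X\<in>T. f X = 0))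
      \<longleftrightarrow> independent D" (is "?L \<longleftrightarrow> _")
  proof
    assume L: ?L
    show "independent D"
      unfolding independent_explicit_module
    proof (intro allI impI)
      fix T :: "'b set" and u :: "'b \<Rightarrow> 'a" and v
      assume T: "finite T" "T \<subseteq> D" "(\<Sum>v\<in>T. scale (u v) v) = 0" "v \<in> T"
      obtain f where f: "\<forall>d\<in>D. f (?c d) = u d" using coeff by blast
      have "quotient_comb scale U f (?c ` T) = U"
        using comb[OF T(1,2)] sums[OF f T(2)] T(3) by simp
      then have "f (?c v) = 0"
        using L[rule_format, of "?c ` T" f "?c v"] T by blast
      then show "u v = 0" using f T by auto
    qed
  next
    assume ind: "independent D"
    show ?L
    proof (intro allI impI, elim conjE)
      fix T f assume T: "finite T" "T \<subseteq> ?c ` D" "quotient_comb scale U f T = U"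
      obtain T' where T': "T' \<subseteq> D" "finite T'" "T = ?c ` T'"
        using finite_subset_image[OF T(1,2)] by blast
      then have "(\<Sum>d\<in>T'. scale (f (?c d)) d) = 0"
        using T(3) comb p_sum by (simp add: coset_eq_U_iff)
      then show "\<forall>X\<in>T. f X = 0"
        using independentD[OF ind T'(2,1)] T'(3) by auto
    qed
  qed
  have spanning: "(\<forall>X\<in>quotient_space W U. \<exists>T f. finite T \<and> T \<subseteq> ?c ` D \<and> X = quotient_comb scale U f T)
      \<longleftrightarrow> p ` W \<subseteq> span D" (is "?L \<longleftrightarrow> _")
  proof
    assume L: ?L
    show "p ` W \<subseteq> span D"
    proof
      fix x assume x: "x \<in> p ` W"
      then have "?c x \<in> quotient_space W U"
        unfolding quotient_space_eq by (rule imageI)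
      from L[rule_format, OF this] obtain T f
        where T: "finite T" "T \<subseteq> ?c ` D" "?c x = quotient_comb scale U f T"
        by (elim exE conjE)
      obtain T' where T': "T' \<subseteq> D" "finite T'" "T = ?c ` T'"
        using finite_subset_image[OF T(1,2)] by blast
      then have "?c x = ?c (\<Sum>d\<in>T'. scale (f (?c d)) d)"
        using T(3) comb[OF T'(2,1)] by simp
      moreover have "p x = x" using x by auto
      ultimately have "x = (\<Sum>d\<in>T'. scale (f (?c d)) d)"
        by (simp only: coset_eq_iff p_sum[OF T'(1)])
      also have "\<dots> \<in> span D"
        using T' by (intro span_sum span_scale span_base) auto
      finally show "x \<in> span D" .
    qed
  next
    assume R: "p ` W \<subseteq> span D"
    show ?L
    proof
      fix X assume "X \<in> quotient_space W U"
      then obtain x where x: "X = ?c x" "x \<in> p ` W"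
        unfolding quotient_space_eq by (rule imageE)
      then obtain T u where T: "finite T" "T \<subseteq> D" "x = (\<Sum>d\<in>T. scale (u d) d)"
        using subsetD[OF R x(2)] unfolding span_explicit by blast
      obtain f where f: "\<forall>d\<in>D. f (?c d) = u d" using coeff by blast
      have "X = quotient_comb scale U f (?c ` T)"
        by (simp only: comb[OF T(1,2)] sums[OF f T(2)] x(1) T(3))
      then show "\<exists>T f. finite T \<and> T \<subseteq> ?c ` D \<and> X = quotient_comb scale U f T"
        using T(1,2) by (intro exI[of _ "?c ` T"] exI[of _ f] conjI finite_imageI image_mono)
    qed
  qed
  have "quotient_basis scale W U (?c ` D) \<longleftrightarrow> independent D \<and> p ` W \<subseteq> span D"
    unfolding quotient_basis_def indep spanning by (simp only: subs simp_thms)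
  moreover have "span D \<subseteq> p ` W"
    by (rule span_minimal[OF D p.subspace_image[OF W]])
  ultimately show ?thesis by blast
qed

lemma quotient_dim_basis:
  assumes "subspace W"
  obtains D where "independent D" "span D = p ` W" "|D| =o quotient_dim scale W U"
proof -
  let ?c = "\<lambda>d. d +o U"
  have sub: "subspace (p ` W)"
    using assms by (rule p.subspace_image)
  obtain D\<^sub>0 where D\<^sub>0: "D\<^sub>0 \<subseteq> p ` W" "independent D\<^sub>0" "p ` W \<subseteq> span D\<^sub>0"
    by (rule maximal_independent_subset)
  \<comment> \<open>Some basis must be exhibited before \<open>SOME\<close> in
    \<open>quotient_dim\<close> is known to pick one.\<close>
  have "quotient_basis scale W U (?c ` D\<^sub>0)"
    unfolding quotient_basis_cosets_iff[OF assms D\<^sub>0(1)]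
    using D\<^sub>0(2,3) span_minimal[OF D\<^sub>0(1) sub] by (intro conjI subset_antisym)
  then have B: "quotient_basis scale W U (SOME B. quotient_basis scale W U B)"
    (is "quotient_basis _ _ _ ?B") by (rule someI)
  then have "?B \<subseteq> ?c ` p ` W"
    unfolding quotient_basis_def quotient_space_eq by (rule conjunct1)
  then obtain D where D: "D \<subseteq> p ` W" "?B = ?c ` D"
    by (meson subset_imageE)
  then have "independent D" "span D = p ` W"
    using B quotient_basis_cosets_iff[OF assms D(1)] unfolding D(2) by blast+
  moreover have "bij_betw ?c D ?B"
    unfolding bij_betw_def D(2) using D(1) by (intro conjI inj_on_coset refl) auto
  then have "|D| =o quotient_dim scale W U"
    unfolding quotient_dim_def by (rule card_of_ordIsoI)
  ultimately show thesis using that by blast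
qed

text \<open>The image under \<open>f\<close> of a basis of p(W) spans f(p(W)), hence contains p(W')
  in its span. Taking \<open>f\<close> to be the identity compares nested subspaces; taking
  \<open>f\<close> to be \<open>p \<circ> s\<close> treats images under a semigroup element
  \<open>s\<close>.\<close>

lemma quotient_dim_le:
  assumes W: "subspace W" "subspace W'"
    and f: "Vector_Spaces.linear scale scale f" and sub: "p ` W' \<subseteq> f ` p ` W"
  shows "quotient_dim scale W' U \<le>o quotient_dim scale W U"
proof -
  obtain D where D: "independent D" "span D = p ` W" "|D| =o quotient_dim scale W U"
    using quotient_dim_basis[OF W(1)] .
  obtain D' where D': "independent D'" "span D' = p ` W'" "|D'| =o quotient_dim scale W' U"
    using quotient_dim_basis[OF W(2)] .
  have "D' \<subseteq> span (f ` D)"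
    using span_superset[of D'] D(2) D'(2) sub pair.linear_span_image[OF f, of D] by auto
  then have "|D'| \<le>o |f ` D|"
    using D'(1) by (rule independent_card_of_le[rotated])
  then have "|D'| \<le>o |D|"
    using card_of_image ordLeq_transitive by blast
  then show ?thesis
    using D(3) D'(3) by (meson ordIso_ordLeq_trans ordIso_symmetric ordLeq_ordIso_trans)
qed

lemma Card_order_quotient_dim: "Card_order (quotient_dim scale W U)"
  by (simp add: quotient_dim_def card_of_Card_order)

section \<open>The semigroup and factorization of its elements\<close>

lemma L_GL_linear: "\<alpha> \<in> L_GL scale U \<Longrightarrow> Vector_Spaces.linear scale scale \<alpha>"
  by (simp add: L_GL_def)

lemma L_GL_in_U: "\<alpha> \<in> L_GL scale U \<Longrightarrow> u \<in> U \<Longrightarrow> \<alpha> u \<in> U"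
  by (auto simp: L_GL_def bij_betw_def)

lemma L_GL_comp: "\<alpha> \<in> L_GL scale U \<Longrightarrow> \<beta> \<in> L_GL scale U \<Longrightarrow> \<beta> \<circ> \<alpha> \<in> L_GL scale U"
  by (auto simp: L_GL_def intro: Vector_Spaces.linear_compose bij_betw_trans)

lemma id_in_L_GL: "id \<in> L_GL scale U"
  by (simp add: L_GL_def linear_id)

lemma subspace_range_L_GL: "\<alpha> \<in> L_GL scale U \<Longrightarrow> subspace (range \<alpha>)"
  using pair.linear_subspace_image[OF L_GL_linear subspace_UNIV] by blast

lemma quotient_dim_subset:
  assumes "subspace W" "subspace W'" "W' \<subseteq> W"
  shows "quotient_dim scale W' U \<le>o quotient_dim scale W U"
  using assms by (intro quotient_dim_le[OF _ _ linear_id]) auto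

lemma quotient_dim_image_le:
  assumes W: "subspace W" and s: "s \<in> L_GL scale U"
  shows "quotient_dim scale (s ` W) U \<le>o quotient_dim scale W U"
proof (rule quotient_dim_le)
  interpret s: Vector_Spaces.linear scale scale s
    using s by (rule L_GL_linear)
  show "subspace W" by fact
  show "subspace (s ` W)" using W by (rule s.subspace_image)
  show "Vector_Spaces.linear scale scale (p \<circ> s)"
    using s.linear_axioms linear_p by (rule Vector_Spaces.linear_compose)
  \<comment> \<open>The difference of \<open>w\<close> and \<open>p w\<close> lies in
    \<open>U\<close>, which \<open>s\<close> preserves and \<open>p\<close> annihilates: on
    representatives, \<open>p \<circ> s\<close> is the map induced by \<open>s\<close> on the
    quotient.\<close>
  have "p (s w) = p (s (p w))" for w
    using L_GL_in_U[OF s diff_p_in_U[of w]] by (simp add: in_U_iff s.diff p.diff)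
  then show "p ` s ` W \<subseteq> (p \<circ> s) ` p ` W"
    unfolding image_image o_def by (intro equalityD1 image_cong refl)
qed

text \<open>The inequality injects a basis \<open>E\<close> for \<open>\<beta>\<close> into a basis
  \<open>D\<close> for \<open>\<alpha>\<close>. On the way in, a map fixing \<open>U\<close> sends
  each vector of \<open>E\<close> to a preimage, modulo \<open>U\<close>, of its partner in
  \<open>D\<close>; on the way out, a second map undoes \<open>\<alpha>\<close> on \<open>U\<close>
  and on these preimages.\<close>

lemma factor_through:
  assumes \<alpha>: "\<alpha> \<in> L_GL scale U" and \<beta>: "\<beta> \<in> L_GL scale U"
    and le: "quotient_dim scale (range \<beta>) U \<le>o quotient_dim scale (range \<alpha>) U"
  shows "\<exists>\<sigma>\<in>L_GL scale U. \<exists>\<tau>\<in>L_GL scale U. \<beta> = \<tau> \<circ> \<alpha> \<circ> \<sigma>"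
proof -
  interpret \<alpha>: Vector_Spaces.linear scale scale \<alpha>
    using \<alpha> by (rule L_GL_linear)
  obtain D where D: "independent D" "span D = p ` range \<alpha>"
      "|D| =o quotient_dim scale (range \<alpha>) U"
    using quotient_dim_basis[OF subspace_range_L_GL[OF \<alpha>]] .
  obtain E where E: "independent E" "span E = p ` range \<beta>"
      "|E| =o quotient_dim scale (range \<beta>) U"
    using quotient_dim_basis[OF subspace_range_L_GL[OF \<beta>]] .
  have "|E| \<le>o |D|"
    using le D(3) E(3) by (meson ordIso_ordLeq_trans ordIso_symmetric ordLeq_ordIso_trans)
  then obtain j where j: "inj_on j E" "j ` E \<subseteq> D"
    by (auto simp: card_of_ordLeq[symmetric])
  have "\<forall>d\<in>D. \<exists>e. p (\<alpha> e) = d"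
    using span_superset[of D] D(2) by auto
  then obtain e where e: "\<And>d. d \<in> D \<Longrightarrow> p (\<alpha> (e d)) = d" by metis
  have bij: "bij_betw \<alpha> U U" using \<alpha> by (simp add: L_GL_def)
  then have inj: "inj_on \<alpha> U" by (rule bij_betw_imp_inj_on)
  \<comment> \<open>The inverse of the restriction of \<open>\<alpha>\<close> to \<open>U\<close>,
    extended linearly to the whole space with values still in \<open>U\<close>.\<close>
  obtain \<delta> where \<delta>: "range \<delta> \<subseteq> U" "Vector_Spaces.linear scale scale \<delta>" "\<And>u. u \<in> U \<Longrightarrow> \<delta> (\<alpha> u) = u"
    using pair.linear_exists_left_inverse_on[OF \<alpha>.linear_axioms subspace_U inj] by blast
  obtain g where g: "Vector_Spaces.linear scale scale g" "\<And>b. b \<in> E \<Longrightarrow> g b = e (j b)"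
    using pair.linear_independent_extend[OF E(1), of "\<lambda>b. e (j b)"] by blast
  \<comment> \<open>the correction term makes the map \<open>\<tau>\<close> below send \<open>\<alpha> (e (j b))\<close> exactly to \<open>b\<close>, not only modulo \<open>U\<close>\<close>
  let ?r = "\<lambda>d. inv_into E j d - \<delta> (\<alpha> (e d) - d)"
  obtain g' where g': "Vector_Spaces.linear scale scale g'" "\<And>d. d \<in> D \<Longrightarrow> g' d = ?r d"
    using pair.linear_independent_extend[OF D(1), of ?r] by blast
  \<comment> \<open>Every \<open>x\<close> splits into \<open>x - p x\<close> in \<open>U\<close>
    and \<open>p x\<close> in the complement \<open>range p\<close>. On \<open>U\<close> the two
    maps act as the identity and as \<open>\<delta>\<close>; on \<open>range p\<close> they act as
    \<open>g\<close> and \<open>g'\<close>.\<close>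
  define \<sigma> where "\<sigma> x = (x - p x) + g (p x)" for x
  define \<tau> where "\<tau> x = \<delta> (x - p x) + g' (p x)" for x
  have q: "Vector_Spaces.linear scale scale (\<lambda>x. x - p x)"
    using pair.linear_compose_sub[OF linear_id linear_p] by simp
  have lin\<sigma>: "Vector_Spaces.linear scale scale \<sigma>"
    using pair.linear_compose_add[OF q Vector_Spaces.linear_compose[OF linear_p g(1)]]
    by (simp add: \<sigma>_def[abs_def] o_def)
  have lin\<tau>: "Vector_Spaces.linear scale scale \<tau>"
    using pair.linear_compose_add[OF Vector_Spaces.linear_compose[OF q \<delta>(2)]
        Vector_Spaces.linear_compose[OF linear_p g'(1)]]
    by (simp add: \<tau>_def[abs_def] o_def)
  have \<sigma>_U: "\<sigma> u = u" if "u \<in> U" for u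
    using that pair.linear_0[OF g(1)] by (simp add: \<sigma>_def in_U_iff)
  have \<tau>_U: "\<tau> u = \<delta> u" if "u \<in> U" for u
    using that pair.linear_0[OF g'(1)] by (simp add: \<tau>_def in_U_iff)
  have \<tau>\<alpha>_U: "\<tau> (\<alpha> u) = u" if "u \<in> U" for u
    using that \<tau>_U \<delta>(3) L_GL_in_U[OF \<alpha>] by simp
  have "bij_betw \<sigma> U U"
    using bij_betw_cong[of U \<sigma> id U] \<sigma>_U by simp
  then have \<sigma>: "\<sigma> \<in> L_GL scale U" using lin\<sigma> by (simp add: L_GL_def)
  have "bij_betw \<tau> U U"
  \<comment> \<open>On \<open>U\<close> the map \<open>\<tau>\<close> inverts
    \<open>\<alpha>\<close>, so \<open>\<alpha>\<close> itself witnesses bijectivity.\<close>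
  proof (rule bij_betw_byWitness[where f' = \<alpha>])
    show "\<forall>u\<in>U. \<alpha> (\<tau> u) = u"
      using \<tau>\<alpha>_U bij_betw_imp_surj_on[OF bij] by (metis imageE)
    show "\<forall>u\<in>U. \<tau> (\<alpha> u) = u" using \<tau>\<alpha>_U by simp
    show "\<tau> ` U \<subseteq> U" using \<tau>_U \<delta>(1) by auto
    show "\<alpha> ` U \<subseteq> U" using L_GL_in_U[OF \<alpha>] by auto
  qed
  then have \<tau>: "\<tau> \<in> L_GL scale U" using lin\<tau> by (simp add: L_GL_def)
  have "\<tau> (\<alpha> (g b)) = b" if b: "b \<in> E" for b
  proof -
    have "j b \<in> D" using b j(2) by auto
    then show ?thesis
      using b by (simp add: \<tau>_def g(2) e g'(2) inv_into_f_f[OF j(1)])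
  qed
  then have inv_basis: "(\<tau> \<circ> (\<alpha> \<circ> g)) b = id b" if "b \<in> E" for b
    using that by simp
  have "Vector_Spaces.linear scale scale (\<tau> \<circ> (\<alpha> \<circ> g))"
    using g(1) \<alpha>.linear_axioms lin\<tau> by (metis Vector_Spaces.linear_compose)
  from pair.linear_eq_on[OF this linear_id _ inv_basis]
  have inv_E: "\<tau> (\<alpha> (g x)) = x" if "x \<in> span E" for x
    using that by simp
  \<comment> \<open>The part of \<open>\<beta> x\<close> in \<open>U\<close> and its part in the
    span of \<open>E\<close> are both recovered, so the composite is the identity on the range of
    \<open>\<beta>\<close>. The first factor of the factorization is therefore
    \<open>\<sigma> \<circ> \<beta>\<close>.\<close>
  have "\<tau> (\<alpha> (\<sigma> (\<beta> x))) = \<beta> x" for x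
  proof -
    have "p (\<beta> x) \<in> span E" using E(2) by simp
    then have "\<tau> (\<alpha> (\<sigma> (\<beta> x))) = (\<beta> x - p (\<beta> x)) + p (\<beta> x)"
      unfolding \<sigma>_def \<alpha>.add pair.linear_add[OF lin\<tau>]
      by (simp only: inv_E \<tau>\<alpha>_U[OF diff_p_in_U])
    then show ?thesis by simp
  qed
  then have "\<beta> = \<tau> \<circ> \<alpha> \<circ> (\<sigma> \<circ> \<beta>)"
    by (simp add: fun_eq_iff)
  then show ?thesis
    using \<tau> L_GL_comp[OF \<beta> \<sigma>] by blast
qed

text \<open>The complementary projection onto \<open>U\<close> is the identity there. It gives
  quotient dimension zero and so makes each \<open>Q(k)\<close> with k at least 1 nonempty.\<close>

lemma exists_L_GL_range_subset: "\<exists>\<alpha>\<in>L_GL scale U. range \<alpha> \<subseteq> U"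
proof
  have "bij_betw (\<lambda>x. x - p x) U U"
    using bij_betw_cong[of U "\<lambda>x. x - p x" id U] by (simp add: in_U_iff)
  then show "(\<lambda>x. x - p x) \<in> L_GL scale U"
    using pair.linear_compose_sub[OF linear_id linear_p] by (simp add: L_GL_def)
  show "range (\<lambda>x. x - p x) \<subseteq> U"
    using diff_p_in_U by auto
qed

lemma cone_le_quotient_dim:
  assumes W: "subspace W" and "\<not> W \<subseteq> U"
  shows "cone \<le>o quotient_dim scale W U"
proof -
  obtain D where D: "independent D" "span D = p ` W" "|D| =o quotient_dim scale W U"
    using quotient_dim_basis[OF W] .
  \<comment> \<open>An empty basis would force p(W) to be zero, putting \<open>W\<close> inside the
    kernel \<open>U\<close>.\<close>
  have "D \<noteq> {}"
    using assms(2) D(2) by (auto simp: in_U_iff)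
  then have "cone \<le>o |D|"
    unfolding cone_def by (rule card_of_singl_ordLeq)
  then show ?thesis using D(3) by (rule ordLeq_ordIso_trans)
qed

lemma quotient_dim_less_cone:
  assumes W: "subspace W" and "W \<subseteq> U"
  shows "quotient_dim scale W U <o cone"
proof -
  obtain D where D: "independent D" "span D = p ` W" "|D| =o quotient_dim scale W U"
    using quotient_dim_basis[OF W] .
  have "span D \<subseteq> {0}"
    using assms(2) D(2) by (auto simp: in_U_iff)
  then have "D \<subseteq> {0}"
    using span_superset[of D] by blast
  then have "D = {}"
    using D(1) dependent_zero by blast
  then have "|D| <o cone"
    by (metis cone_def card_of_empty3 insert_not_empty card_of_Well_order not_ordLeq_iff_ordLess)
  then show ?thesis using D(3) by (meson ordIso_ordLess_trans ordIso_symmetric)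
qed

section \<open>Classification of the proper ideals\<close>

lemma proper_ideal_Q:
  assumes k: "Card_order k" "cone \<le>o k" "k \<le>o quotient_dim scale UNIV U"
  shows "proper_ideal right_comp (L_GL scale U) (Q scale U k)"
  unfolding proper_ideal_def right_comp_def
proof (intro conjI ballI)
  show "Q scale U k \<subseteq> L_GL scale U"
    by (auto simp: Q_def)
  show "Q scale U k \<noteq> {}"
    using exists_L_GL_range_subset subspace_range_L_GL quotient_dim_less_cone k(2)
    unfolding Q_def by (blast intro: ordLess_ordLeq_trans)
  \<comment> \<open>The identity has the full quotient dimension, which is at least
    \<open>k\<close>, and is therefore missing.\<close>
  show "Q scale U k \<noteq> L_GL scale U"
    using id_in_L_GL k(3) not_ordLess_ordLeq by (fastforce simp: Q_def)
next
  fix s a assume s: "s \<in> L_GL scale U" and a: "a \<in> Q scale U k"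
  then have a': "a \<in> L_GL scale U" by (simp add: Q_def)
  \<comment> \<open>Applying \<open>s\<close> first can only shrink the range; applying it
    afterwards, below, replaces the range of \<open>a\<close> by its image under \<open>s\<close>.
    Neither raises the quotient dimension.\<close>
  have "quotient_dim scale (range (a \<circ> s)) U \<le>o quotient_dim scale (range a) U"
    using s a' by (intro quotient_dim_subset subspace_range_L_GL L_GL_comp) auto
  then show "a \<circ> s \<in> Q scale U k"
    using a s L_GL_comp by (auto simp: Q_def intro: ordLeq_ordLess_trans)
  have "quotient_dim scale (range (s \<circ> a)) U \<le>o quotient_dim scale (range a) U"
    using quotient_dim_image_le[OF subspace_range_L_GL[OF a'] s] by (simp add: image_comp)
  then show "s \<circ> a \<in> Q scale U k"
    using a s L_GL_comp by (auto simp: Q_def intro: ordLeq_ordLess_trans)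
qed

lemma proper_ideal_is_Q:
  assumes I: "proper_ideal right_comp (L_GL scale U) I"
  shows "\<exists>k :: 'b set rel. I = Q scale U k \<and> Card_order k \<and> cone \<le>o k \<and> k \<le>o quotient_dim scale UNIV U"
proof -
  let ?S = "L_GL scale U"
  let ?d = "\<lambda>\<alpha>. quotient_dim scale (range \<alpha>) U"
  have IS: "I \<subseteq> ?S" and "I \<noteq> {}" and "I \<noteq> ?S"
    and left: "\<And>s a. s \<in> ?S \<Longrightarrow> a \<in> I \<Longrightarrow> a \<circ> s \<in> I"
    and right: "\<And>s a. s \<in> ?S \<Longrightarrow> a \<in> I \<Longrightarrow> s \<circ> a \<in> I"
    using I by (auto simp: proper_ideal_def right_comp_def)
  \<comment> \<open>Membership in an ideal is inherited by every map of no larger quotient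
    dimension; this reduces ideals to initial segments of cardinals.\<close>
  have down: "\<beta> \<in> I" if le: "\<alpha> \<in> I" "\<beta> \<in> ?S" "?d \<beta> \<le>o ?d \<alpha>" for \<alpha> \<beta>
  proof -
    obtain \<sigma> \<tau> where "\<sigma> \<in> ?S" "\<tau> \<in> ?S" "\<beta> = \<tau> \<circ> \<alpha> \<circ> \<sigma>"
      using factor_through[of \<alpha> \<beta>] le IS by blast
    then show ?thesis using left right le(1) by simp
  qed
  \<comment> \<open>Properness leaves some map outside \<open>I\<close>, and cardinals are
    well-ordered, so a least quotient dimension outside \<open>I\<close> is attained; it serves as
    k.\<close>
  have "?d ` (?S - I) \<noteq> {}" using IS \<open>I \<noteq> ?S\<close> by auto
  then obtain \<beta> where \<beta>: "\<beta> \<in> ?S" "\<beta> \<notin> I" and min: "\<And>\<gamma>. \<gamma> \<in> ?S - I \<Longrightarrow> ?d \<beta> \<le>o ?d \<gamma>"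
    using exists_minim_Card_order[of "?d ` (?S - I)"] Card_order_quotient_dim by auto
  have less: "?d \<gamma> <o ?d \<beta> \<longleftrightarrow> \<not> ?d \<beta> \<le>o ?d \<gamma>" for \<gamma>
    by (rule not_ordLeq_iff_ordLess[symmetric])
      (simp_all add: quotient_dim_def card_of_Well_order)
  \<comment> \<open>A member of \<open>I\<close> with dimension at least that of
    \<open>\<beta>\<close> would pull \<open>\<beta>\<close> into \<open>I\<close>; a map of smaller
    dimension lies in \<open>I\<close> by minimality.\<close>
  have "I = Q scale U (?d \<beta>)"
  proof (intro set_eqI iffI)
    fix \<alpha> assume "\<alpha> \<in> I"
    then show "\<alpha> \<in> Q scale U (?d \<beta>)"
      using IS \<beta> down less by (auto simp: Q_def)
  next
    fix \<alpha> assume "\<alpha> \<in> Q scale U (?d \<beta>)"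
    then show "\<alpha> \<in> I" using min less by (auto simp: Q_def)
  qed
  \<comment> \<open>This gives the bound 1 on k from below. Members of \<open>I\<close> map
    \<open>U\<close> onto itself, so their ranges contain \<open>U\<close>; if the range of
    \<open>\<beta>\<close> lay in \<open>U\<close>, \<open>\<beta>\<close> would be forced into the
    nonempty \<open>I\<close>.\<close>
  moreover have "\<not> range \<beta> \<subseteq> U"
  proof
    assume "range \<beta> \<subseteq> U"
    obtain \<alpha> where \<alpha>: "\<alpha> \<in> I" using \<open>I \<noteq> {}\<close> by blast
    then have "\<alpha> ` U = U" using IS by (auto simp: L_GL_def bij_betw_def)
    then have "U \<subseteq> range \<alpha>" by blast
    then have "?d \<beta> \<le>o ?d \<alpha>"
      using \<open>range \<beta> \<subseteq> U\<close> \<alpha> \<beta>(1) IS by (intro quotient_dim_subset subspace_range_L_GL) auto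
    then show False using down \<alpha> \<beta> by blast
  qed
  then have "cone \<le>o ?d \<beta>"
    using \<beta>(1) by (intro cone_le_quotient_dim subspace_range_L_GL)
  moreover have "?d \<beta> \<le>o quotient_dim scale UNIV U"
    using \<beta>(1) by (intro quotient_dim_subset subspace_range_L_GL subspace_UNIV) auto
  ultimately show ?thesis
    using Card_order_quotient_dim by blast
qed

end

theorem theorem3p6:
  fixes scale :: "'a::field \<Rightarrow> 'b::ab_group_add \<Rightarrow> 'b"
    and U :: "'b set"
  assumes "vector_space scale"
    and "module.subspace scale U"
    and "U \<noteq> UNIV"
  shows "{I. proper_ideal right_comp (L_GL scale U) I} =
    {Q scale U k | k :: 'b set rel.
       Card_order k \<and> cone \<le>o k \<and> k \<le>o quotient_dim scale UNIV U}"
proof -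
  interpret vector_space scale by fact
  obtain p where "Vector_Spaces.linear scale scale p" "\<And>x. p (p x) = p x" "{x. p x = 0} = U"
    using exists_projection_with_kernel[OF assms(2)] by blast
  then interpret projection scale U p
    by (intro projection.intro projection_axioms.intro vector_space_axioms)
  show ?thesis
    using proper_ideal_Q proper_ideal_is_Q by auto
qed

end
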